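(* Let $f\in C(\mathbb{T})$ and $h>0$. Then $$\frac49\,\widetilde{K}_2\left(f,\frac h8,\frac{h}{4\sqrt3}\right)\le W_2^*(f,\chi_h)\le 2\,\widetilde{K}_2\left(f,\frac h8,\frac{h}{4\sqrt3}\right).$$
   Context: $C(\mathbb{T})$, $\mathbb{T}=\mathbb{R}/\mathbb{Z}$, is the space of real continuous $1$-periodic functions with the uniform norm $\|f\|=\sup_{u\in\mathbb{T}}|f(u)|$. $D$ is the derivative operator; $C^1(\mathbb{T})$ and $C^2(\mathbb{T})$ are the spaces of $1$-periodic functions $g$ with $Dg\in C(\mathbb{T})$, respectively $D^2g\in C(\mathbb{T})$. For a periodic $f$ and a nonnegative integrable $g$ with bounded support on $\mathbb{R}$, $(f*g)(t)=\int_{\mathbb{R}}f(u)\,g(t-u)\,du$. For $h>0$, $\chi_h$ is the function on $\mathbb{R}$ equal to $1/h$ on $(-h/2,h/2)$ and $0$ elsewhere. Define $$W_2(f,\chi_h)=\|f-f*\chi_h\|,\qquad W_2^*(f,\chi_h)=\sup_{0<u\le h}W_2(f,\chi_u).$$ For $f\in C(\mathbb{T})$ and $h_1,h_2>0$ the generalized $K$-functional is $$\widetilde{K}_2(f,h_1,h_2)=\inf_{g_1\in C^1(\mathbb{T}),\;g_2\in C^2(\mathbb{T})}\{\|f-g_1\|+h_1\|D(g_1-g_2)\|+h_2^2\|D^2g_2\|\}.$$ *)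

theory Defs
  imports "HOL-Analysis.Analysis"
begin

text \<open>Functions on the circle \<open>\<real>/\<int>\<close> are represented as 1-periodic functions on \<open>\<real>\<close>.\<close>

definition periodic1 :: "(real \<Rightarrow> real) \<Rightarrow> bool" where
  "periodic1 f \<longleftrightarrow> (\<forall>x. f (x + 1) = f x)"

definition C_T :: "(real \<Rightarrow> real) set" where
  "C_T = {f. periodic1 f \<and> continuous_on UNIV f}"

text \<open>Differentiability is required explicitly because \<^const>\<open>deriv\<close> is total and has an
  unspecified value where the derivative does not exist.\<close>

definition C1_T :: "(real \<Rightarrow> real) set" where
  "C1_T = {g. periodic1 g \<and> (\<forall>x. g differentiable (at x)) \<and> deriv g \<in> C_T}"

definition C2_T :: "(real \<Rightarrow> real) set" where
  "C2_T = {g. periodic1 g \<and> (\<forall>x. g differentiable (at x)) \<and>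
     (\<forall>x. deriv g differentiable (at x)) \<and> deriv (deriv g) \<in> C_T}"

text \<open>By periodicity, the supremum over the circle is the supremum over \<open>\<real>\<close>. The real-valued
  \<open>SUP\<close> is meaningful only for bounded functions, such as those in \<^const>\<open>C_T\<close>.\<close>

definition unorm :: "(real \<Rightarrow> real) \<Rightarrow> real" where
  "unorm f = (SUP u. \<bar>f u\<bar>)"

definition conv :: "(real \<Rightarrow> real) \<Rightarrow> (real \<Rightarrow> real) \<Rightarrow> real \<Rightarrow> real" where
  "conv f g t = (LINT u|lborel. f u * g (t - u))"

definition chi :: "real \<Rightarrow> real \<Rightarrow> real" where
  "chi h x = (if x \<in> {- h / 2 <..< h / 2} then 1 / h else 0)"

definition W2 :: "(real \<Rightarrow> real) \<Rightarrow> (real \<Rightarrow> real) \<Rightarrow> real" where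
  "W2 f k = unorm (\<lambda>t. f t - conv f k t)"

text \<open>The scale \<open>h\<close> is the argument here, not the kernel \<open>chi h\<close>: the supremum runs over the
  family of kernels \<open>chi u\<close> with \<open>0 < u \<le> h\<close>.\<close>

definition W2_star :: "(real \<Rightarrow> real) \<Rightarrow> real \<Rightarrow> real" where
  "W2_star f h = (SUP u\<in>{0<..h}. W2 f (chi u))"

definition K2 :: "(real \<Rightarrow> real) \<Rightarrow> real \<Rightarrow> real \<Rightarrow> real" where
  "K2 f h1 h2 = (INF (g1, g2)\<in>C1_T \<times> C2_T.
     unorm (\<lambda>x. f x - g1 x) + h1 * unorm (deriv (\<lambda>x. g1 x - g2 x))
       + h2\<^sup>2 * unorm (deriv (deriv g2)))"

end

theory Submission imports Defs begin

text \<open>Write \<open>A\<^sub>u g\<close> for the mean of \<open>g\<close> over the window of length \<open>u\<close> centred at the argument, so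
  that \<open>f * \<chi>\<^sub>u = A\<^sub>u f\<close>. The upper bound follows by splitting \<open>f = (f - g\<^sub>1) + (g\<^sub>1 - g\<^sub>2) + g\<^sub>2\<close> and
  bounding \<open>\<parallel>g - A\<^sub>u g\<parallel>\<close> by \<open>2\<parallel>g\<parallel>\<close>, \<open>u\<parallel>Dg\<parallel>/4\<close> and \<open>u\<^sup>2\<parallel>D\<^sup>2g\<parallel>/24\<close> respectively.

  For the lower bound take \<open>g\<^sub>1 = A\<^sub>h f\<close> and \<open>g\<^sub>2 = A\<^sub>h A\<^sub>h f\<close>, and let \<open>W = W\<^sub>2\<^sup>*(f, \<chi>\<^sub>h)\<close>. Then
  \<open>\<parallel>f - g\<^sub>1\<parallel> \<le> W\<close> and \<open>\<parallel>D(g\<^sub>1 - g\<^sub>2)\<parallel> = \<parallel>D A\<^sub>h (f - A\<^sub>h f)\<parallel> \<le> 2W/h\<close>, while \<open>h\<^sup>2 D\<^sup>2g\<^sub>2\<close> is the second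
  difference \<open>B f\<close> of \<open>f\<close> with step \<open>h\<close>. The difference \<open>A\<^sub>h g\<^sub>2 - g\<^sub>2\<close> is \<open>1/24\<close> times a mixture of the
  functions \<open>A\<^sub>u B f\<close> with \<open>u \<le> h\<close>, each within \<open>4W\<close> of \<open>B f\<close>; as \<open>\<parallel>A\<^sub>h g\<^sub>2 - g\<^sub>2\<parallel> \<le> W\<close>, this gives
  \<open>\<parallel>B f\<parallel> \<le> 28W\<close>. Finally \<open>1 + 1/4 + 28/48 < 9/4\<close>.\<close>

section \<open>Window means and antiderivatives\<close>

definition avg :: "real \<Rightarrow> (real \<Rightarrow> real) \<Rightarrow> real \<Rightarrow> real" where
  "avg u g t = integral {t - u / 2..t + u / 2} g / u"

definition sdiff :: "(real \<Rightarrow> real) \<Rightarrow> real \<Rightarrow> real \<Rightarrow> real" where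
  "sdiff g t s = g (t + s) - 2 * g t + g (t - s)"

text \<open>An antiderivative on the whole line turns every mean into a difference quotient, so
  differentiating, translating and commuting means become algebra.\<close>

lemma continuous_real_antiderivative:
  fixes g :: "real \<Rightarrow> real"
  assumes "continuous_on UNIV g"
  obtains F where "\<And>x. (F has_real_derivative g x) (at x)"
proof -
  have "\<exists>F. \<forall>x::real. -\<infinity> < ereal x \<longrightarrow> ereal x < \<infinity> \<longrightarrow> (F has_vector_derivative g x) (at x)"
    using assms by (intro einterval_antiderivative) (auto simp: continuous_on_eq_continuous_at)
  then show ?thesis
    using that by (auto simp: has_real_derivative_iff_has_vector_derivative)
qed

lemma integral_eq_antiderivative_diff:
  fixes F g :: "real \<Rightarrow> real"
  assumes "\<And>x. (F has_real_derivative g x) (at x)" "a \<le> b"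
  shows "integral {a..b} g = F b - F a"
proof (intro integral_unique fundamental_theorem_of_calculus \<open>a \<le> b\<close>)
  show "(F has_vector_derivative g x) (at x within {a..b})" for x
    using has_field_derivative_at_within[OF assms(1)]
    by (simp add: has_real_derivative_iff_has_vector_derivative)
qed

lemma avg_eq_antiderivative_diff:
  assumes "\<And>x. (F has_real_derivative g x) (at x)" "u > 0"
  shows "avg u g t = (F (t + u / 2) - F (t - u / 2)) / u"
  using integral_eq_antiderivative_diff[OF assms(1)] assms(2) by (simp add: avg_def)

lemma conv_chi_eq_avg:
  assumes "continuous_on UNIV g" "u > 0"
  shows "conv g (chi u) t = avg u g t"
proof -
  let ?I = "{t - u / 2<..<t + u / 2}"
  have "g x * chi u (t - x) = (indicator ?I x *\<^sub>R g x) / u" for x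
    by (auto simp: chi_def indicator_def)
  then have "conv g (chi u) t = (LINT x:?I|lborel. g x) / u"
    by (simp add: conv_def set_lebesgue_integral_def)
  also have "(LINT x:?I|lborel. g x) = integral ?I g"
  proof (rule set_borel_integral_eq_integral)
    have "set_integrable lborel {t - u / 2..t + u / 2} g"
      using assms(1) by (intro borel_integrable_atLeastAtMost')
        (auto intro: continuous_on_subset)
    then show "set_integrable lborel ?I g"
      by (rule set_integrable_subset) auto
  qed
  also have "\<dots> = integral {t - u / 2..t + u / 2} g"
    by (simp add: integral_open_interval_real)
  finally show ?thesis
    by (simp add: avg_def)
qed

lemma has_real_derivative_avg:
  assumes "continuous_on UNIV g" "u > 0"
  shows "(avg u g has_real_derivative (g (t + u / 2) - g (t - u / 2)) / u) (at t)"
proof -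
  obtain F where F: "\<And>x. (F has_real_derivative g x) (at x)"
    using continuous_real_antiderivative[OF assms(1)] by blast
  have "((\<lambda>t. (F (t + u / 2) - F (t - u / 2)) / u) has_real_derivative
      (g (t + u / 2) - g (t - u / 2)) / u) (at t)"
    using assms(2) by (auto intro!: derivative_eq_intros DERIV_chain2[OF F])
  then show ?thesis
    using avg_eq_antiderivative_diff[OF F assms(2)] by presburger
qed

lemma continuous_avg:
  assumes "continuous_on UNIV g" "u > 0"
  shows "continuous_on UNIV (avg u g)"
  using has_real_derivative_avg[OF assms]
  by (auto simp: continuous_on_eq_continuous_at intro: DERIV_isCont)

lemma avg_shift:
  assumes "continuous_on UNIV g" "u > 0"
  shows "avg u (\<lambda>x. g (x + c)) t = avg u g (t + c)"
proof -
  obtain F where F: "\<And>x. (F has_real_derivative g x) (at x)"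
    using continuous_real_antiderivative[OF assms(1)] by blast
  have "((\<lambda>x. F (x + c)) has_real_derivative g (x + c)) (at x)" for x
    by (rule iffD1[OF DERIV_shift F])
  from avg_eq_antiderivative_diff[OF this assms(2)] show ?thesis
    using avg_eq_antiderivative_diff[OF F assms(2)] by (simp add: algebra_simps)
qed

lemma avg_in_C_T:
  assumes "g \<in> C_T" "u > 0"
  shows "avg u g \<in> C_T"
  using assms avg_shift[of g u 1] continuous_avg[of g u]
  by (auto simp: C_T_def periodic1_def)

lemma avg_diff:
  assumes "continuous_on UNIV g" "continuous_on UNIV k"
  shows "avg u (\<lambda>x. g x - k x) t = avg u g t - avg u k t"
proof -
  have "g integrable_on {a..b}" "k integrable_on {a..b}" for a b
    using assms by (auto intro: integrable_continuous_real continuous_on_subset)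
  then show ?thesis
    by (simp add: avg_def integral_diff diff_divide_distrib)
qed

lemma abs_avg_le:
  assumes "continuous_on UNIV g" "u > 0" "\<And>x. \<bar>g x\<bar> \<le> M"
  shows "\<bar>avg u g t\<bar> \<le> M"
proof -
  have "norm (integral {t - u / 2..t + u / 2} g) \<le> M * (t + u / 2 - (t - u / 2))"
    using assms by (intro integral_bound) (auto intro: continuous_on_subset)
  then show ?thesis
    using assms(2) by (simp add: avg_def field_simps)
qed

section \<open>Comparison estimates for means and second differences\<close>

text \<open>\<open>q - b * m - c * m\<close> decreases, \<open>q - b * m + c * m\<close> increases
  (both weakly), and both start at \<open>0\<close>. The constants \<open>b\<close> and
  \<open>c\<close> survive integration, so the estimate can be iterated. The upper bound uses
  \<open>b = 0\<close>, the lower one a second difference over \<open>h\<^sup>2\<close>.\<close>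

lemma abs_increment_le:
  fixes q m :: "real \<Rightarrow> real"
  assumes q: "\<And>s. (q has_real_derivative q' s) (at s)"
    and m: "\<And>s. (m has_real_derivative m' s) (at s)"
    and "q 0 = 0" "m 0 = 0" "0 \<le> r"
    and le: "\<And>s. 0 \<le> s \<Longrightarrow> s \<le> r \<Longrightarrow> \<bar>q' s - b * m' s\<bar> \<le> c * m' s"
  shows "\<bar>q r - b * m r\<bar> \<le> c * m r"
proof -
  have "q r - b * m r - c * m r \<le> q 0 - b * m 0 - c * m 0"
  proof (rule DERIV_nonpos_imp_nonincreasing[OF \<open>0 \<le> r\<close>])
    fix s assume s: "0 \<le> s" "s \<le> r"
    have "((\<lambda>s. q s - b * m s - c * m s) has_real_derivative q' s - b * m' s - c * m' s) (at s)"
      by (auto intro!: derivative_eq_intros q m)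
    then show "\<exists>y. ((\<lambda>s. q s - b * m s - c * m s) has_real_derivative y) (at s) \<and> y \<le> 0"
      using le[OF s] by (intro exI[of _ "q' s - b * m' s - c * m' s"]) auto
  qed
  moreover have "q 0 - b * m 0 + c * m 0 \<le> q r - b * m r + c * m r"
  proof (rule DERIV_nonneg_imp_nondecreasing[OF \<open>0 \<le> r\<close>])
    fix s assume s: "0 \<le> s" "s \<le> r"
    have "((\<lambda>s. q s - b * m s + c * m s) has_real_derivative q' s - b * m' s + c * m' s) (at s)"
      by (auto intro!: derivative_eq_intros q m)
    then show "\<exists>y. ((\<lambda>s. q s - b * m s + c * m s) has_real_derivative y) (at s) \<and> 0 \<le> y"
      using le[OF s] by (intro exI[of _ "q' s - b * m' s + c * m' s"]) auto
  qed
  ultimately show ?thesis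
    using assms(3,4) by auto
qed

text \<open>Integrating \<open>sdiff g t s\<close> over \<open>s\<close> from \<open>0\<close> to
  \<open>u / 2\<close> gives \<open>u * (avg u g t - g t)\<close>; \<open>?q\<close> below is this
  integral with variable upper end.\<close>

lemma avg_minus_self_estimate:
  assumes g: "continuous_on UNIV g" and "u > 0"
    and m: "\<And>s. (m has_real_derivative m' s) (at s)" "m 0 = 0"
    and le: "\<And>s. 0 \<le> s \<Longrightarrow> s \<le> u / 2 \<Longrightarrow> \<bar>sdiff g t s - b * m' s\<bar> \<le> c * m' s"
  shows "\<bar>u * (avg u g t - g t) - b * m (u / 2)\<bar> \<le> c * m (u / 2)"
proof -
  obtain F where F: "\<And>x. (F has_real_derivative g x) (at x)"
    using continuous_real_antiderivative[OF g] by blast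
  let ?q = "\<lambda>s. F (t + s) - F (t - s) - 2 * s * g t"
  have "(?q has_real_derivative sdiff g t s) (at s)" for s
    unfolding sdiff_def by (auto intro!: derivative_eq_intros DERIV_chain2[OF F])
  then have "\<bar>?q (u / 2) - b * m (u / 2)\<bar> \<le> c * m (u / 2)"
    by (rule abs_increment_le[OF _ m(1) _ m(2)]) (use le \<open>u > 0\<close> in auto)
  moreover have "?q (u / 2) = u * (avg u g t - g t)"
    using avg_eq_antiderivative_diff[OF F \<open>u > 0\<close>] \<open>u > 0\<close> by (simp add: field_simps)
  ultimately show ?thesis
    by simp
qed

lemma sdiff_estimate:
  assumes g: "\<And>x. (g has_real_derivative g' x) (at x)" and "0 \<le> r"
    and le: "\<And>s. 0 \<le> s \<Longrightarrow> s \<le> r \<Longrightarrow> \<bar>g' (t + s) - g' (t - s) - b * (2 * s)\<bar> \<le> c * (2 * s)"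
  shows "\<bar>sdiff g t r - b * r\<^sup>2\<bar> \<le> c * r\<^sup>2"
proof (rule abs_increment_le[OF _ _ _ _ \<open>0 \<le> r\<close> le])
  show "(sdiff g t has_real_derivative g' (t + s) - g' (t - s)) (at s)" for s
    unfolding sdiff_def by (auto intro!: derivative_eq_intros DERIV_chain2[OF g])
  show "((\<lambda>s. s\<^sup>2) has_real_derivative 2 * s) (at s)" for s :: real
    by (auto intro!: derivative_eq_intros)
qed (auto simp: sdiff_def)

lemma lipschitz_of_deriv_bound:
  fixes g :: "real \<Rightarrow> real"
  assumes "\<And>x. (g has_real_derivative g' x) (at x)" "\<And>x. \<bar>g' x\<bar> \<le> M"
  shows "\<bar>g x - g y\<bar> \<le> M * \<bar>x - y\<bar>"
  using field_differentiable_bound[of UNIV g g' M x y] assms by auto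

text \<open>Two Lipschitz bounds give \<open>2 * M * s\<close> for the second difference;
  integration up to \<open>u / 2\<close> gives \<open>M * (u / 2)\<^sup>2\<close>, and division by
  \<open>u\<close> leaves \<open>u / 4\<close>.\<close>

lemma abs_self_minus_avg_le_deriv:
  assumes g: "\<And>x. (g has_real_derivative g' x) (at x)" and M: "\<And>x. \<bar>g' x\<bar> \<le> M" and "u > 0"
  shows "\<bar>g t - avg u g t\<bar> \<le> u / 4 * M"
proof -
  have "\<bar>sdiff g t s - 0 * (2 * s)\<bar> \<le> M * (2 * s)" if "0 \<le> s" for s
    using lipschitz_of_deriv_bound[OF g M, of "t + s" t]
      lipschitz_of_deriv_bound[OF g M, of "t - s" t] that
    by (simp add: sdiff_def)
  moreover have "((\<lambda>s. s\<^sup>2) has_real_derivative 2 * s) (at s)" for s :: real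
    by (auto intro!: derivative_eq_intros)
  moreover have "continuous_on UNIV g"
    using g by (auto simp: continuous_on_eq_continuous_at intro: DERIV_isCont)
  ultimately have "\<bar>u * (avg u g t - g t) - 0 * (u / 2)\<^sup>2\<bar> \<le> M * (u / 2)\<^sup>2"
    using \<open>u > 0\<close> by (intro avg_minus_self_estimate[where m' = "\<lambda>s. 2 * s"]) auto
  then show ?thesis
    using \<open>u > 0\<close> by (simp add: abs_mult power2_eq_square abs_minus_commute mult.commute)
qed

lemma has_real_derivative_cube_third:
  "((\<lambda>s. s ^ 3 / 3) has_real_derivative s\<^sup>2) (at (s::real))"
  by (auto intro!: derivative_eq_intros)

text \<open>Two integrations take the bound \<open>2 * M * s\<close> for increments of
  \<open>g'\<close> to \<open>M * s\<^sup>2\<close> and then to \<open>M * (u / 2) ^ 3 / 3\<close>,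
  whence the \<open>24\<close>.\<close>

lemma abs_self_minus_avg_le_deriv2:
  assumes g: "\<And>x. (g has_real_derivative g' x) (at x)"
    and g': "\<And>x. (g' has_real_derivative g'' x) (at x)"
    and M: "\<And>x. \<bar>g'' x\<bar> \<le> M" and "u > 0"
  shows "\<bar>g t - avg u g t\<bar> \<le> u\<^sup>2 / 24 * M"
proof -
  have "\<bar>g' (t + s) - g' (t - s) - 0 * (2 * s)\<bar> \<le> M * (2 * s)" if "0 \<le> s" for s
    using lipschitz_of_deriv_bound[OF g' M, of "t + s" "t - s"] that by simp
  then have "\<bar>sdiff g t s - 0 * s\<^sup>2\<bar> \<le> M * s\<^sup>2" if "0 \<le> s" for s
    using that by (intro sdiff_estimate[OF g]) auto
  moreover have "continuous_on UNIV g"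
    using g by (auto simp: continuous_on_eq_continuous_at intro: DERIV_isCont)
  ultimately have "\<bar>u * (avg u g t - g t) - 0 * ((u / 2) ^ 3 / 3)\<bar> \<le> M * ((u / 2) ^ 3 / 3)"
    using \<open>u > 0\<close> has_real_derivative_cube_third
    by (intro avg_minus_self_estimate[where m' = "\<lambda>s. s\<^sup>2"]) auto
  then show ?thesis
    using \<open>u > 0\<close>
    by (simp add: abs_mult power2_eq_square power3_eq_cube abs_minus_commute mult.commute)
qed

section \<open>Periodic functions, the uniform norm and smoothness classes\<close>

text \<open>Compactness bounds \<open>g\<close> on the unit interval, and periodicity carries the
  bound to \<open>x\<close> through \<open>frac x\<close>. This makes the supremum in
  \<open>unorm\<close> meaningful.\<close>

lemma C_T_bounded:
  assumes "g \<in> C_T"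
  shows "bdd_above (range (\<lambda>x. \<bar>g x\<bar>))"
proof -
  have "compact (g ` {0..1})"
    using assms by (intro compact_continuous_image) (auto simp: C_T_def intro: continuous_on_subset)
  then obtain M where M: "\<And>x. x \<in> {0..1} \<Longrightarrow> \<bar>g x\<bar> \<le> M"
    using compact_imp_bounded by (fastforce simp: bounded_iff)
  have per: "g (x + 1) = g x" for x
    using assms by (simp add: C_T_def periodic1_def)
  have shift: "g (x + of_int n) = g x" for x n
  proof (induction n arbitrary: x rule: int_induct[where k = 0])
    case (step1 i)
    then show ?case
      using per by (simp add: add.assoc[symmetric])
  next
    case (step2 i)
    from step2(2)[of "x - 1"] show ?case
      using per[of "x - 1"] by (simp add: algebra_simps)
  qed simp
  have "\<bar>g x\<bar> \<le> M" for x
    using shift[of "frac x" "\<lfloor>x\<rfloor>"] M[of "frac x"] frac_ge_0[of x] frac_lt_1[of x]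
    by (auto simp: frac_def)
  then show ?thesis
    by (auto simp: bdd_above_def)
qed

lemma abs_le_unorm: "g \<in> C_T \<Longrightarrow> \<bar>g x\<bar> \<le> unorm g"
  unfolding unorm_def by (intro cSUP_upper C_T_bounded) auto

lemma unorm_le: "(\<And>x. \<bar>g x\<bar> \<le> M) \<Longrightarrow> unorm g \<le> M"
  unfolding unorm_def by (intro cSUP_least) auto

lemma unorm_nonneg: "g \<in> C_T \<Longrightarrow> 0 \<le> unorm g"
  using abs_le_unorm[of g 0] by linarith

lemma C_T_diff: "f \<in> C_T \<Longrightarrow> g \<in> C_T \<Longrightarrow> (\<lambda>x. f x - g x) \<in> C_T"
  by (auto simp: C_T_def periodic1_def intro: continuous_on_diff)

lemma C_T_shift:
  assumes "f \<in> C_T"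
  shows "(\<lambda>x. f (x + c)) \<in> C_T"
proof -
  have "f (x + 1 + c) = f (x + c)" for x
    using assms by (simp add: C_T_def periodic1_def add.assoc add.commute[of 1])
      (simp flip: add.assoc)
  moreover have "continuous_on UNIV (\<lambda>x. f (x + c))"
    by (rule continuous_on_compose2[of UNIV f])
      (use assms in \<open>auto simp: C_T_def intro!: continuous_on_add continuous_on_id continuous_on_const\<close>)
  ultimately show ?thesis
    by (simp add: C_T_def periodic1_def)
qed

lemma C_T_divide: "f \<in> C_T \<Longrightarrow> (\<lambda>x. f x / c) \<in> C_T"
  by (cases "c = 0") (auto simp: C_T_def periodic1_def intro!: continuous_intros)

lemma periodic_differentiable_in_C_T:
  assumes "periodic1 g" "\<And>x. (g has_real_derivative g' x) (at x)"
  shows "g \<in> C_T"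
  using assms by (auto simp: C_T_def continuous_on_eq_continuous_at intro: DERIV_isCont)

text \<open>By uniqueness of derivatives. It supplies the periodicity of \<open>deriv g\<close> that
  places \<open>C2_T\<close> inside \<open>C1_T\<close>.\<close>

lemma periodic1_deriv:
  assumes "periodic1 g" "\<And>x. g differentiable (at x)"
  shows "periodic1 (deriv g)"
proof -
  have D: "(g has_real_derivative deriv g x) (at x)" for x
    using assms(2) by (simp add: DERIV_deriv_iff_real_differentiable)
  have "((\<lambda>x. g (x + 1)) has_real_derivative deriv g (x + 1)) (at x)" for x
    by (rule iffD1[OF DERIV_shift D])
  then have "(g has_real_derivative deriv g (x + 1)) (at x)" for x
    using assms(1) by (simp add: periodic1_def)
  then show ?thesis
    using DERIV_unique[OF _ D] by (simp add: periodic1_def)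
qed

lemma C1_T_D:
  assumes "g \<in> C1_T"
  shows "g \<in> C_T" "deriv g \<in> C_T" "\<And>x. (g has_real_derivative deriv g x) (at x)"
proof -
  show D: "(g has_real_derivative deriv g x) (at x)" for x
    using assms by (simp add: C1_T_def DERIV_deriv_iff_real_differentiable)
  show "g \<in> C_T" "deriv g \<in> C_T"
    using assms periodic_differentiable_in_C_T[OF _ D] by (auto simp: C1_T_def)
qed

lemma C2_T_D:
  assumes "g \<in> C2_T"
  shows "g \<in> C1_T" "deriv (deriv g) \<in> C_T"
    "\<And>x. (deriv g has_real_derivative deriv (deriv g) x) (at x)"
proof -
  show D: "(deriv g has_real_derivative deriv (deriv g) x) (at x)" for x
    using assms by (simp add: C2_T_def DERIV_deriv_iff_real_differentiable)
  show "g \<in> C1_T" "deriv (deriv g) \<in> C_T"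
    using assms periodic_differentiable_in_C_T[OF _ D] periodic1_deriv[of g]
    by (auto simp: C1_T_def C2_T_def)
qed

lemma deriv_diff_C1_T:
  assumes "g1 \<in> C1_T" "g2 \<in> C1_T"
  shows "deriv (\<lambda>x. g1 x - g2 x) = (\<lambda>x. deriv g1 x - deriv g2 x)"
  using C1_T_D(3)[OF assms(1)] C1_T_D(3)[OF assms(2)]
  by (auto intro!: DERIV_imp_deriv derivative_eq_intros)

text \<open>Each averaging gains one derivative; applied once and twice to \<open>f\<close>, it
  yields the pair inserted into the \<open>K\<close>-functional.\<close>

lemma avg_in_C1_T:
  assumes "g \<in> C_T" "u > 0"
  shows "avg u g \<in> C1_T" "deriv (avg u g) = (\<lambda>t. (g (t + u / 2) - g (t - u / 2)) / u)"
proof -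
  have D: "(avg u g has_real_derivative (g (t + u / 2) - g (t - u / 2)) / u) (at t)" for t
    using assms has_real_derivative_avg by (auto simp: C_T_def)
  then show eq: "deriv (avg u g) = (\<lambda>t. (g (t + u / 2) - g (t - u / 2)) / u)"
    by (auto intro: DERIV_imp_deriv)
  have "deriv (avg u g) \<in> C_T"
    unfolding eq using C_T_shift[OF assms(1), of "u / 2"] C_T_shift[OF assms(1), of "- (u / 2)"]
    by (intro C_T_divide C_T_diff) auto
  then show "avg u g \<in> C1_T"
    using avg_in_C_T[OF assms] D by (auto simp: C1_T_def C_T_def real_differentiable_def)
qed

lemma avg_avg_in_C2_T:
  assumes "g \<in> C_T" "u > 0"
  shows "avg u (avg u g) \<in> C2_T" "deriv (deriv (avg u (avg u g))) = (\<lambda>t. sdiff g t u / u\<^sup>2)"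
proof -
  note 1 = avg_in_C1_T[OF assms] and 2 = avg_in_C1_T[OF avg_in_C_T[OF assms] assms(2)]
  have D: "(avg u g has_real_derivative (g (t + u / 2) - g (t - u / 2)) / u) (at t)" for t
    using assms has_real_derivative_avg by (auto simp: C_T_def)
  have D2: "(deriv (avg u (avg u g)) has_real_derivative sdiff g t u / u\<^sup>2) (at t)" for t
  proof -
    have "((\<lambda>t. (avg u g (t + u / 2) - avg u g (t - u / 2)) / u) has_real_derivative
        ((g (t + u / 2 + u / 2) - g (t + u / 2 - u / 2)) / u
          - (g (t - u / 2 + u / 2) - g (t - u / 2 - u / 2)) / u) / u) (at t)"
      using assms(2) by (auto intro!: derivative_eq_intros DERIV_chain2[OF D])
    also have "((g (t + u / 2 + u / 2) - g (t + u / 2 - u / 2)) / u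
        - (g (t - u / 2 + u / 2) - g (t - u / 2 - u / 2)) / u) / u = sdiff g t u / u\<^sup>2"
    proof -
      have "t + u / 2 + u / 2 = t + u" "t - u / 2 - u / 2 = t - u"
        by simp_all
      then show ?thesis
        by (simp add: sdiff_def power2_eq_square diff_divide_distrib add_divide_distrib add.commute)
    qed
    finally show ?thesis
      by (simp only: 2(2))
  qed
  then show eq: "deriv (deriv (avg u (avg u g))) = (\<lambda>t. sdiff g t u / u\<^sup>2)"
    by (auto intro: DERIV_imp_deriv)
  \<comment> \<open>Regrouped as a difference of first differences, so that the closure properties
    of \<open>C_T\<close> apply.\<close>
  have "(\<lambda>t. sdiff g t u / u\<^sup>2) = (\<lambda>t. ((g (t + u) - g t) - (g t - g (t + - u))) / u\<^sup>2)"
    by (auto simp: sdiff_def)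
  also have "\<dots> \<in> C_T"
    by (intro C_T_divide C_T_diff C_T_shift assms(1))
  finally have "deriv (deriv (avg u (avg u g))) \<in> C_T"
    by (simp add: eq)
  then show "avg u (avg u g) \<in> C2_T"
    using 2(1) D2 by (auto simp: C1_T_def C2_T_def real_differentiable_def)
qed

section \<open>Deviation from the mean and the upper estimate\<close>

lemma W2_chi_eq: "f \<in> C_T \<Longrightarrow> u > 0 \<Longrightarrow> W2 f (chi u) = unorm (\<lambda>t. f t - avg u f t)"
  by (simp add: W2_def conv_chi_eq_avg C_T_def)

lemma abs_self_minus_avg_le:
  assumes "f \<in> C_T" "u > 0"
  shows "\<bar>f t - avg u f t\<bar> \<le> 2 * unorm f"
proof -
  have "\<bar>avg u f t\<bar> \<le> unorm f"
    using assms abs_le_unorm by (intro abs_avg_le) (auto simp: C_T_def)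
  then show ?thesis
    using abs_le_unorm[OF assms(1), of t] by linarith
qed

lemma abs_self_minus_avg_le_W2_star:
  assumes "f \<in> C_T" "0 < u" "u \<le> h"
  shows "\<bar>f t - avg u f t\<bar> \<le> W2_star f h"
proof -
  have "\<bar>f t - avg u f t\<bar> \<le> W2 f (chi u)"
    unfolding W2_chi_eq[OF assms(1,2)]
    by (rule abs_le_unorm[OF C_T_diff[OF assms(1) avg_in_C_T[OF assms(1,2)]]])
  also have "\<dots> \<le> W2_star f h"
    unfolding W2_star_def
  proof (rule cSUP_upper)
    \<comment> \<open>A bound uniform in the scale, needed for the real-valued supremum to dominate
      its members.\<close>
    show "bdd_above ((\<lambda>u. W2 f (chi u)) ` {0<..h})"
      using assms(1) abs_self_minus_avg_le[OF assms(1)]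
      by (intro bdd_aboveI2[of _ _ "2 * unorm f"]) (auto simp: W2_chi_eq intro: unorm_le)
  qed (use assms in auto)
  finally show ?thesis .
qed

text \<open>The weights \<open>2\<close>, \<open>h / 4\<close>, \<open>h\<^sup>2 / 24\<close> are
  twice the weights \<open>1\<close>, \<open>h / 8\<close>, \<open>h\<^sup>2 / 48\<close> of the
  \<open>K\<close>-functional; hence the factor \<open>2\<close> in the upper bound.\<close>

lemma W2_chi_le:
  assumes f: "f \<in> C_T" and u: "0 < u" "u \<le> h" and g1: "g1 \<in> C1_T" and g2: "g2 \<in> C2_T"
  shows "W2 f (chi u) \<le> 2 * unorm (\<lambda>x. f x - g1 x) + h / 4 * unorm (deriv (\<lambda>x. g1 x - g2 x))
    + h\<^sup>2 / 24 * unorm (deriv (deriv g2))"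
  unfolding W2_chi_eq[OF f u(1)]
proof (rule unorm_le)
  fix t
  note 1 = C1_T_D[OF g1] and 2 = C1_T_D[OF C2_T_D(1)[OF g2]] and 3 = C2_T_D[OF g2]
  let ?p = "\<lambda>x. f x - g1 x" and ?q = "\<lambda>x. g1 x - g2 x"
  have eq: "deriv ?q = (\<lambda>x. deriv g1 x - deriv g2 x)"
    by (rule deriv_diff_C1_T[OF g1 3(1)])
  have q: "deriv ?q \<in> C_T"
    unfolding eq by (rule C_T_diff[OF 1(2) 2(2)])
  have "\<bar>?p t - avg u ?p t\<bar> \<le> 2 * unorm ?p"
    by (rule abs_self_minus_avg_le[OF C_T_diff[OF f 1(1)] u(1)])
  moreover have "\<bar>?q t - avg u ?q t\<bar> \<le> u / 4 * unorm (deriv ?q)"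
  proof (rule abs_self_minus_avg_le_deriv[OF _ abs_le_unorm[OF q] u(1)])
    show "(?q has_real_derivative deriv ?q x) (at x)" for x
      unfolding eq by (auto intro!: derivative_eq_intros 1(3) 2(3))
  qed
  moreover have "u / 4 * unorm (deriv ?q) \<le> h / 4 * unorm (deriv ?q)"
    using u unorm_nonneg[OF q] by (intro mult_right_mono) auto
  moreover have "\<bar>g2 t - avg u g2 t\<bar> \<le> u\<^sup>2 / 24 * unorm (deriv (deriv g2))"
    by (rule abs_self_minus_avg_le_deriv2[OF 2(3) 3(3) abs_le_unorm[OF 3(2)] u(1)])
  moreover have "u\<^sup>2 / 24 * unorm (deriv (deriv g2)) \<le> h\<^sup>2 / 24 * unorm (deriv (deriv g2))"
    using u unorm_nonneg[OF 3(2)] by (intro mult_right_mono divide_right_mono power_mono) auto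
  moreover have "f t - avg u f t = (?p t - avg u ?p t) + (?q t - avg u ?q t) + (g2 t - avg u g2 t)"
    using f 1(1) 2(1) by (simp add: avg_diff C_T_def)
  ultimately show "\<bar>f t - avg u f t\<bar> \<le> 2 * unorm ?p + h / 4 * unorm (deriv ?q)
    + h\<^sup>2 / 24 * unorm (deriv (deriv g2))"
    by linarith
qed

section \<open>Lower estimate: the second difference of \<open>f\<close>\<close>

text \<open>For \<open>g = A\<^sub>h A\<^sub>h f\<close>, commuting the two differences in \<open>g'(t + s) - g'(t - s)\<close> turns it into
  \<open>2s/h\<^sup>2\<close> times the second difference of \<open>A\<^sub>2\<^sub>s f\<close>.\<close>

lemma avg_deriv_increment:
  assumes f: "f \<in> C_T" and "h > 0" "s > 0"
  defines "g' \<equiv> \<lambda>x. (avg h f (x + h / 2) - avg h f (x - h / 2)) / h"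
  shows "g' (t + s) - g' (t - s) = 2 * s / h\<^sup>2 * sdiff (avg (2 * s) f) t h"
proof -
  obtain F where F: "\<And>x. (F has_real_derivative f x) (at x)"
    using continuous_real_antiderivative f by (auto simp: C_T_def)
  have A: "avg u f x = (F (x + u / 2) - F (x - u / 2)) / u" if "u > 0" for u x
    by (rule avg_eq_antiderivative_diff[OF F that])
  have "t + s + h / 2 + h / 2 = t + h + s" "t + s + h / 2 - h / 2 = t + s"
    "t + s - h / 2 + h / 2 = t + s" "t + s - h / 2 - h / 2 = t - h + s"
    "t - s + h / 2 + h / 2 = t + h - s" "t - s + h / 2 - h / 2 = t - s"
    "t - s - h / 2 + h / 2 = t - s" "t - s - h / 2 - h / 2 = t - h - s"
    by simp_all
  then show ?thesis
    using assms(2,3) by (simp add: g'_def sdiff_def A power2_eq_square) (simp add: field_simps)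
qed

lemma sdiff_le_W2_star:
  assumes f: "f \<in> C_T" and h: "h > 0"
  shows "\<bar>sdiff f t h\<bar> \<le> 28 * W2_star f h"
proof -
  define W where "W = W2_star f h"
  have W: "\<bar>f x - avg u f x\<bar> \<le> W" if "0 < u" "u \<le> h" for u x
    unfolding W_def by (rule abs_self_minus_avg_le_W2_star[OF f that])
  let ?a = "avg h f"
  let ?g = "avg h ?a"
  let ?g' = "\<lambda>x. (?a (x + h / 2) - ?a (x - h / 2)) / h"
  have cont: "continuous_on UNIV f" "continuous_on UNIV ?a" "continuous_on UNIV ?g"
    using f h continuous_avg by (auto simp: C_T_def)
  \<comment> \<open>The coefficients 1, -2, 1 make the replacement of \<open>f\<close> by its mean
    of length \<open>2 * s\<close> cost at most \<open>4 * W\<close>; \<open>s \<le> h / 2\<close>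
    keeps this length within \<open>h\<close>. At \<open>s = 0\<close> the window degenerates, but
    both sides vanish.\<close>
  have incr: "\<bar>?g' (t + s) - ?g' (t - s) - sdiff f t h / h\<^sup>2 * (2 * s)\<bar> \<le> 4 * W / h\<^sup>2 * (2 * s)"
    if s: "0 \<le> s" "s \<le> h / 2" for s
  proof (cases "s = 0")
    case False
    with s have "s > 0" by simp
    let ?d = "sdiff (avg (2 * s) f) t h - sdiff f t h"
    have "\<bar>?d\<bar> \<le> 4 * W"
      using W[of "2 * s" "t + h"] W[of "2 * s" t] W[of "2 * s" "t - h"] s \<open>s > 0\<close>
      by (simp add: sdiff_def)
    then have "\<bar>2 * s / h\<^sup>2 * ?d\<bar> \<le> 2 * s / h\<^sup>2 * (4 * W)"
      using \<open>s > 0\<close> unfolding abs_mult by (intro mult_mono) auto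
    then show ?thesis
      unfolding avg_deriv_increment[OF f h \<open>s > 0\<close>] by (simp add: algebra_simps)
  qed simp
  have "\<bar>sdiff ?g t s - sdiff f t h / h\<^sup>2 * s\<^sup>2\<bar> \<le> 4 * W / h\<^sup>2 * s\<^sup>2"
    if "0 \<le> s" "s \<le> h / 2" for s
    by (rule sdiff_estimate[OF has_real_derivative_avg[OF cont(2) h] that(1) incr])
      (use that in auto)
  then have "\<bar>h * (avg h ?g t - ?g t) - sdiff f t h / h\<^sup>2 * ((h / 2) ^ 3 / 3)\<bar>
      \<le> 4 * W / h\<^sup>2 * ((h / 2) ^ 3 / 3)"
    by (intro avg_minus_self_estimate[OF cont(3) h has_real_derivative_cube_third]) auto
  moreover have "c / h\<^sup>2 * ((h / 2) ^ 3 / 3) = h * (c / 24)" for c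
    using h by (simp add: power2_eq_square power3_eq_cube)
  ultimately have "\<bar>h * (avg h ?g t - ?g t) - h * (sdiff f t h / 24)\<bar> \<le> h * (4 * W / 24)"
    by (simp only:)
  then have "\<bar>avg h ?g t - ?g t - sdiff f t h / 24\<bar> \<le> 4 * W / 24"
    unfolding right_diff_distrib[symmetric] using h
    by (simp only: abs_mult abs_of_pos mult_le_cancel_left_pos)
  \<comment> \<open>\<open>?g - avg h ?g\<close> is the twofold mean of \<open>f - ?a\<close>, and
    means preserve a uniform bound.\<close>
  moreover have "\<bar>?g t - avg h ?g t\<bar> \<le> W"
  proof -
    have "\<bar>avg h (avg h (\<lambda>x. f x - ?a x)) t\<bar> \<le> W"
      using h cont W by (intro abs_avg_le continuous_avg continuous_on_diff) auto
    moreover have "avg h (\<lambda>x. f x - ?a x) = (\<lambda>x. ?a x - ?g x)"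
      using cont by (auto simp: avg_diff)
    ultimately show ?thesis
      using cont by (simp add: avg_diff)
  qed
  \<comment> \<open>Here \<open>24 * (W + 4 * W / 24) = 28 * W\<close>.\<close>
  ultimately show ?thesis
    unfolding W_def by linarith
qed

theorem theorem2:
  fixes f :: "real \<Rightarrow> real" and h :: real
  assumes "f \<in> C_T" and "h > 0"
  shows "4 / 9 * K2 f (h / 8) (h / (4 * sqrt 3)) \<le> W2_star f h \<and>
         W2_star f h \<le> 2 * K2 f (h / 8) (h / (4 * sqrt 3))"
proof
  have h2: "(h / (4 * sqrt 3))\<^sup>2 = h\<^sup>2 / 48"
    by (simp add: power_divide power_mult_distrib)
  define J where "J = (\<lambda>(g1, g2). unorm (\<lambda>x. f x - g1 x)
    + h / 8 * unorm (deriv (\<lambda>x. g1 x - g2 x)) + h\<^sup>2 / 48 * unorm (deriv (deriv g2)))"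
  have K: "K2 f (h / 8) (h / (4 * sqrt 3)) = (INF p\<in>C1_T \<times> C2_T. J p)"
    by (simp add: K2_def J_def h2)
  let ?g1 = "avg h f" and ?g2 = "avg h (avg h f)"
  let ?W = "W2_star f h"
  note g1 = avg_in_C1_T[OF assms] and g2 = avg_avg_in_C2_T[OF assms]
  have W: "\<bar>f x - ?g1 x\<bar> \<le> ?W" for x
    using abs_self_minus_avg_le_W2_star[OF assms(1)] assms(2) by auto

  have "K2 f (h / 8) (h / (4 * sqrt 3)) \<le> J (?g1, ?g2)"
    unfolding K
  proof (rule cINF_lower)
    have "0 \<le> J (k1, k2)" if "k1 \<in> C1_T" "k2 \<in> C2_T" for k1 k2
      using C1_T_D[OF that(1)] C1_T_D[OF C2_T_D(1)[OF that(2)]] C2_T_D[OF that(2)] assms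
        deriv_diff_C1_T[OF that(1) C2_T_D(1)[OF that(2)]]
      by (auto simp: J_def intro!: add_nonneg_nonneg mult_nonneg_nonneg unorm_nonneg C_T_diff)
    then show "bdd_below (J ` (C1_T \<times> C2_T))"
      by (intro bdd_belowI2[of _ 0]) auto
  qed (use g1 g2 in auto)
  also have "\<dots> \<le> ?W + h / 8 * (2 * ?W / h) + h\<^sup>2 / 48 * (28 * ?W / h\<^sup>2)"
  proof -
    have "unorm (\<lambda>x. f x - ?g1 x) \<le> ?W"
      using W by (rule unorm_le)
    moreover have "unorm (deriv (\<lambda>x. ?g1 x - ?g2 x)) \<le> 2 * ?W / h"
    proof (rule unorm_le)
      fix x
      \<comment> \<open>By linearity this is itself a mean, so its derivative is a difference
        quotient of \<open>f - ?g1\<close> with step \<open>h\<close>.\<close>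
      have "(\<lambda>x. ?g1 x - ?g2 x) = avg h (\<lambda>x. f x - ?g1 x)"
        using assms avg_in_C_T[OF assms] by (auto simp: avg_diff C_T_def)
      moreover have "(\<lambda>x. f x - ?g1 x) \<in> C_T"
        by (rule C_T_diff[OF assms(1) avg_in_C_T[OF assms]])
      ultimately have "deriv (\<lambda>x. ?g1 x - ?g2 x) x
          = ((f (x + h / 2) - ?g1 (x + h / 2)) - (f (x - h / 2) - ?g1 (x - h / 2))) / h"
        using avg_in_C1_T(2) assms(2) by simp
      then show "\<bar>deriv (\<lambda>x. ?g1 x - ?g2 x) x\<bar> \<le> 2 * ?W / h"
        using W[of "x + h / 2"] W[of "x - h / 2"] assms(2)
        by (simp add: divide_right_mono)
    qed
    moreover have "unorm (deriv (deriv ?g2)) \<le> 28 * ?W / h\<^sup>2"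
      unfolding g2(2) using sdiff_le_W2_star[OF assms]
      by (intro unorm_le) (simp add: divide_right_mono)
    ultimately show ?thesis
      using assms(2) unfolding J_def prod.case by (intro add_mono mult_left_mono) auto
  qed
  also have "\<dots> = (11 / 6) * ?W"
    using assms(2) by (simp add: field_simps)
  \<comment> \<open>Enlarging the constant needs \<open>0 \<le> ?W\<close>, which the bound
    \<open>W\<close> at any point supplies.\<close>
  also have "\<dots> \<le> 9 / 4 * ?W"
    using W[of 0] by simp
  finally show "4 / 9 * K2 f (h / 8) (h / (4 * sqrt 3)) \<le> ?W"
    by simp

  have "?W / 2 \<le> K2 f (h / 8) (h / (4 * sqrt 3))"
    unfolding K
  proof (rule cINF_greatest)
    show "C1_T \<times> C2_T \<noteq> {}"
      using g1 g2 by blast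
    fix p assume "p \<in> C1_T \<times> C2_T"
    then obtain k1 k2 where p: "p = (k1, k2)" "k1 \<in> C1_T" "k2 \<in> C2_T"
      by blast
    have "?W \<le> 2 * J p"
      unfolding W2_star_def
    proof (rule cSUP_least)
      show "{0<..h} \<noteq> {}"
        using assms(2) by simp
      show "W2 f (chi u) \<le> 2 * J p" if "u \<in> {0<..h}" for u
        using W2_chi_le[OF assms(1) _ _ p(2,3), of u h] that by (simp add: J_def p(1) mult.commute)
    qed
    then show "?W / 2 \<le> J p"
      by simp
  qed
  then show "?W \<le> 2 * K2 f (h / 8) (h / (4 * sqrt 3))"
    by simp
qed

end
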